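(* Let $S$ be the Phillips symmetric operator in $\mathfrak{H}$, let $J$ be a fundamental symmetry in $\mathfrak{H}$ commuting with $S$, and let $B$ be a $J$-self-adjoint extension of $S$. Then either $\sigma(B)=\mathbb{R}$, or $\sigma(B)=\mathbb{C}$ and every non-real point of $\sigma(B)$ is an eigenvalue of $B$.
   Context: Phillips symmetric operator: let $U$ be a unitary operator in a Hilbert space $\mathfrak{H}$ which is a bilateral shift with a finite-dimensional wandering subspace $W_0$ (the subspaces $U^nW_0$, $n\in\mathbb{Z}$, are mutually orthogonal with orthogonal sum $\mathfrak{H}$); $V=U\upharpoonright(\mathfrak{H}\ominus W_0)$, $S=i(V+I)(V-I)^{-1}$, $\mathcal{D}(S)=\mathcal{R}(V-I)$. A fundamental symmetry is a bounded $J$ with $J=J^*$, $J^2=I$; $J$ commutes with $S$ if $J\mathcal{D}(S)\subset\mathcal{D}(S)$ and $JSu=SJu$. A densely defined operator $B$ is $J$-self-adjoint if $B^*J=JB$; a $J$-self-adjoint extension of $S$ is such a $B$ with $S\subset B$. $\sigma(B)$ is the spectrum of the closed operator $B$. *)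

theory Defs
  imports "HOL-Analysis.Analysis"
begin

class chilbert = banach +
  fixes scaleC :: "complex \<Rightarrow> 'a \<Rightarrow> 'a"
    and cinner :: "'a \<Rightarrow> 'a \<Rightarrow> complex"
  assumes scaleC_add_right: "scaleC a (x + y) = scaleC a x + scaleC a y"
    and scaleC_add_left: "scaleC (a + b) x = scaleC a x + scaleC b x"
    and scaleC_scaleC: "scaleC a (scaleC b x) = scaleC (a * b) x"
    and scaleC_one: "scaleC 1 x = x"
    and scaleC_of_real: "scaleC (complex_of_real r) x = scaleR r x"
    and cinner_conj: "cinner x y = cnj (cinner y x)"
    and cinner_add_right: "cinner x (y + z) = cinner x y + cinner x z"
    and cinner_scaleC_right: "cinner x (scaleC a y) = a * cinner x y"
    and cinner_self_norm: "cinner x x = complex_of_real ((norm x)\<^sup>2)"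

definition clinear :: "('a::chilbert \<Rightarrow> 'b::chilbert) \<Rightarrow> bool" where
  "clinear f \<longleftrightarrow> (\<forall>x y. f (x + y) = f x + f y) \<and> (\<forall>a x. f (scaleC a x) = scaleC a (f x))"

definition bounded_clinear :: "('a::chilbert \<Rightarrow> 'b::chilbert) \<Rightarrow> bool" where
  "bounded_clinear f \<longleftrightarrow> clinear f \<and> (\<exists>K. \<forall>x. norm (f x) \<le> K * norm x)"

definition csubspace :: "'a::chilbert set \<Rightarrow> bool" where
  "csubspace M \<longleftrightarrow> 0 \<in> M \<and> (\<forall>x\<in>M. \<forall>y\<in>M. x + y \<in> M) \<and> (\<forall>a. \<forall>x\<in>M. scaleC a x \<in> M)"

definition cspan :: "'a::chilbert set \<Rightarrow> 'a set" where
  "cspan F = csubspace hull F"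

definition orth :: "'a::chilbert set \<Rightarrow> 'a set" where
  "orth W = {x. \<forall>w\<in>W. cinner w x = 0}"

definition unitary :: "('a::chilbert \<Rightarrow> 'a) \<Rightarrow> bool" where
  "unitary U \<longleftrightarrow> clinear U \<and> surj U \<and> (\<forall>x y. cinner (U x) (U y) = cinner x y)"

definition upow :: "('a \<Rightarrow> 'a) \<Rightarrow> int \<Rightarrow> 'a \<Rightarrow> 'a" where
  "upow U n = (if 0 \<le> n then U ^^ nat n else inv U ^^ nat (- n))"

definition bilateral_shift :: "('a::chilbert \<Rightarrow> 'a) \<Rightarrow> 'a set \<Rightarrow> bool" where
  "bilateral_shift U W0 \<longleftrightarrow>
     unitary U \<and>
     (\<exists>F. finite F \<and> W0 = cspan F) \<and> W0 \<noteq> {0} \<and>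
     (\<forall>m n. m \<noteq> n \<longrightarrow> (\<forall>x\<in>upow U m ` W0. \<forall>y\<in>upow U n ` W0. cinner x y = 0)) \<and>
     closure (cspan (\<Union>n. upow U n ` W0)) = UNIV"

definition dom_op :: "('a \<times> 'b) set \<Rightarrow> 'a set" where
  "dom_op G = fst ` G"

definition lin_op :: "('a::chilbert \<times> 'a) set \<Rightarrow> bool" where
  "lin_op G \<longleftrightarrow> (0, 0) \<in> G \<and>
     (\<forall>x y u v. (x, y) \<in> G \<longrightarrow> (u, v) \<in> G \<longrightarrow> (x + u, y + v) \<in> G) \<and>
     (\<forall>a x y. (x, y) \<in> G \<longrightarrow> (scaleC a x, scaleC a y) \<in> G) \<and>
     (\<forall>x y z. (x, y) \<in> G \<longrightarrow> (x, z) \<in> G \<longrightarrow> y = z)"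

definition densely_defined :: "('a::chilbert \<times> 'a) set \<Rightarrow> bool" where
  "densely_defined G \<longleftrightarrow> lin_op G \<and> closure (dom_op G) = UNIV"

definition adjoint_op :: "('a::chilbert \<times> 'a) set \<Rightarrow> ('a \<times> 'a) set" where
  "adjoint_op G = {(y, z). \<forall>(x, w)\<in>G. cinner w y = cinner x z}"

definition op_comp_right :: "('a \<times> 'a) set \<Rightarrow> ('a \<Rightarrow> 'a) \<Rightarrow> ('a \<times> 'a) set" where
  "op_comp_right G J = {(x, z). (J x, z) \<in> G}"

definition op_comp_left :: "('a \<Rightarrow> 'a) \<Rightarrow> ('a \<times> 'a) set \<Rightarrow> ('a \<times> 'a) set" where
  "op_comp_left J G = {(x, J w) | x w. (x, w) \<in> G}"

definition fundamental_symmetry :: "('a::chilbert \<Rightarrow> 'a) \<Rightarrow> bool" where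
  "fundamental_symmetry J \<longleftrightarrow> bounded_clinear J \<and>
     (\<forall>x y. cinner (J x) y = cinner x (J y)) \<and> (\<forall>x. J (J x) = x)"

definition commutes_with :: "('a \<Rightarrow> 'a) \<Rightarrow> ('a \<times> 'a) set \<Rightarrow> bool" where
  "commutes_with J G \<longleftrightarrow> J ` dom_op G \<subseteq> dom_op G \<and>
     (\<forall>u v. (u, v) \<in> G \<longrightarrow> (J u, J v) \<in> G)"

definition J_selfadjoint :: "('a::chilbert \<Rightarrow> 'a) \<Rightarrow> ('a \<times> 'a) set \<Rightarrow> bool" where
  "J_selfadjoint J B \<longleftrightarrow> densely_defined B \<and> op_comp_right (adjoint_op B) J = op_comp_left J B"

text \<open>Phillips symmetric operator \<open>S = i(V+I)(V-I)^{-1}\<close>, \<open>D(S) = R(V-I)\<close>,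
  \<open>V = U\<restriction>(\<HH> \<ominus> W0)\<close>: its graph is \<open>{((V-I)x, i(V+I)x) | x \<in> \<HH> \<ominus> W0}\<close>.\<close>
definition phillips_op :: "('a::chilbert \<Rightarrow> 'a) \<Rightarrow> 'a set \<Rightarrow> ('a \<times> 'a) set" where
  "phillips_op U W0 = {(U x - x, scaleC \<i> (U x + x)) | x. x \<in> orth W0}"

text \<open>Spectrum: complement of the resolvent set, where \<open>z\<close> is in the resolvent set iff
  \<open>(B - z)^{-1}\<close> exists as an everywhere defined bounded operator.\<close>
definition spectrum_op :: "('a::chilbert \<times> 'a) set \<Rightarrow> complex set" where
  "spectrum_op B = {z. \<not> (\<exists>R. bounded_clinear R \<and>
       {(w - scaleC z x, x) | x w. (x, w) \<in> B} = {(y, R y) | y. True})}"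

definition eigenvalue_op :: "('a::chilbert \<times> 'a) set \<Rightarrow> complex \<Rightarrow> bool" where
  "eigenvalue_op B z \<longleftrightarrow> (\<exists>x. x \<noteq> 0 \<and> (x, scaleC z x) \<in> B)"

end

theory Submission
  imports Defs
begin

text \<open>Since \<open>S \<subseteq> B \<subseteq> S\<^sup>*\<close>, the Cayley transform of \<open>B\<close> consists of pairs
  \<open>(a + h, U (b + h))\<close> with \<open>h\<close> orthogonal to \<open>W0\<close> and \<open>(a, b)\<close> in a subspace \<open>L\<close> of
  \<open>W0 \<times> W0\<close>, and a point \<open>z\<close> of the upper half plane corresponds to the pencil \<open>p - \<epsilon> q\<close> with
  \<open>\<epsilon> = (z - \<i>) / (z + \<i>)\<close>, \<open>\<bar>\<epsilon>\<bar> < 1\<close>. Because \<open>(1 - \<epsilon> U)\<^sup>-\<^sup>1\<close> maps \<open>U W0\<close> into the orthogonal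
  complement of \<open>W0\<close>, the pencil is boundedly invertible or has a kernel according to whether
  \<open>L\<close> contains some \<open>(0, b)\<close> with \<open>b \<noteq> 0\<close>, a condition independent of \<open>z\<close>. Reversing all pairs
  and replacing \<open>U\<close> by its inverse gives the lower half plane, with the condition that \<open>L\<close>
  contains some \<open>(a, 0)\<close> with \<open>a \<noteq> 0\<close>. The two conditions are equivalent: \<open>J\<close>-self-adjointness
  makes \<open>L\<close> maximal, so that \<open>L\<close> has the same dimension as \<open>W0\<close>. Finally, real points are in the
  spectrum because \<open>1 - \<epsilon> U\<close> is not bounded below for \<open>\<bar>\<epsilon>\<bar> = 1\<close>.\<close>

section \<open>Elementary algebra of scalar multiplication, inner product and norm\<close>

lemma scaleC_zero_right [simp]: "scaleC a (0::'a::chilbert) = 0"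
  using scaleC_add_right[of a 0 0] by simp

lemma scaleC_zero_left [simp]: "scaleC 0 (x::'a::chilbert) = 0"
  using scaleC_add_left[of 0 0 x] by simp

lemma scaleC_minus_right [simp]: "scaleC a (- x) = - scaleC a (x::'a::chilbert)"
  using scaleC_add_right[of a x "- x"] by (simp add: eq_neg_iff_add_eq_0 add.commute)

lemma scaleC_minus_left [simp]: "scaleC (- a) x = - scaleC a (x::'a::chilbert)"
  using scaleC_add_left[of a "- a" x] by (simp add: eq_neg_iff_add_eq_0 add.commute)

lemma scaleC_diff_right: "scaleC a (x - y) = scaleC a x - scaleC a (y::'a::chilbert)"
  using scaleC_add_right[of a x "- y"] by simp

lemma scaleC_diff_left: "scaleC (a - b) x = scaleC a x - scaleC b (x::'a::chilbert)"
  using scaleC_add_left[of a "- b" x] by simp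

lemma scaleC_sum_right: "scaleC a (\<Sum>i\<in>A. f i) = (\<Sum>i\<in>A. scaleC a (f i :: 'a::chilbert))"
  by (induction A rule: infinite_finite_induct) (simp_all add: scaleC_add_right)

lemmas scaleC_distribs = scaleC_add_right scaleC_add_left scaleC_diff_right scaleC_diff_left

declare scaleC_one [simp] scaleC_scaleC [simp]

lemma scaleR_eq_scaleC: "scaleR r x = scaleC (complex_of_real r) (x::'a::chilbert)"
  by (simp add: scaleC_of_real)

lemma cinner_add_left: "cinner (x + y) z = cinner x z + cinner y (z::'a::chilbert)"
  by (metis cinner_add_right cinner_conj complex_cnj_add)

lemma cinner_scaleC_left: "cinner (scaleC a x) y = cnj a * cinner x (y::'a::chilbert)"
  by (metis cinner_scaleC_right cinner_conj complex_cnj_mult)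

lemma cinner_zero_right [simp]: "cinner x (0::'a::chilbert) = 0"
  using cinner_add_right[of x 0 0] by simp

lemma cinner_zero_left [simp]: "cinner (0::'a::chilbert) x = 0"
  using cinner_add_left[of 0 0 x] by simp

lemma cinner_minus_right [simp]: "cinner x (- y) = - cinner x (y::'a::chilbert)"
  using cinner_add_right[of x y "- y"] by (simp add: eq_neg_iff_add_eq_0 add.commute)

lemma cinner_minus_left [simp]: "cinner (- x) y = - cinner x (y::'a::chilbert)"
  using cinner_add_left[of x "- x" y] by (simp add: eq_neg_iff_add_eq_0 add.commute)

lemma cinner_diff_right: "cinner x (y - z) = cinner x y - cinner x (z::'a::chilbert)"
  using cinner_add_right[of x y "- z"] by simp

lemma cinner_diff_left: "cinner (x - y) z = cinner x z - cinner y (z::'a::chilbert)"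
  using cinner_add_left[of x "- y" z] by simp

lemma cinner_sum_right: "cinner x (\<Sum>i\<in>A. f i) = (\<Sum>i\<in>A. cinner x (f i :: 'a::chilbert))"
  by (induction A rule: infinite_finite_induct) (simp_all add: cinner_add_right)

lemmas cinner_distribs = cinner_add_right cinner_add_left cinner_diff_right cinner_diff_left
  cinner_scaleC_right cinner_scaleC_left

lemma cinner_eq_0_commute: "cinner x y = 0 \<longleftrightarrow> cinner y (x::'a::chilbert) = 0"
  by (metis cinner_conj complex_cnj_zero)

lemma cinner_self_eq_0 [simp]: "cinner x x = 0 \<longleftrightarrow> x = (0::'a::chilbert)"
  by (simp add: cinner_self_norm)

lemma norm_eq_of_cinner_eq:
  fixes x :: "'a::chilbert" and y :: "'b::chilbert"
  assumes "cinner x x = cinner y y"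
  shows "norm x = norm y"
proof -
  have "(norm x)\<^sup>2 = (norm y)\<^sup>2"
    using assms by (simp only: cinner_self_norm of_real_eq_iff)
  then show ?thesis by simp
qed

lemma norm_scaleC [simp]: "norm (scaleC a x) = cmod a * norm (x::'a::chilbert)"
proof -
  have "cinner (scaleC a x) (scaleC a x) = (cnj a * a) * cinner x x"
    by (simp add: cinner_distribs)
  also have "\<dots> = complex_of_real ((cmod a * norm x)\<^sup>2)"
    by (metis cinner_self_norm complex_norm_square mult.commute of_real_mult power_mult_distrib)
  finally have "(norm (scaleC a x))\<^sup>2 = (cmod a * norm x)\<^sup>2"
    by (simp only: cinner_self_norm of_real_eq_iff)
  then show ?thesis by simp
qed

lemma scaleC_eq_0_iff [simp]: "scaleC a x = 0 \<longleftrightarrow> a = 0 \<or> x = (0::'a::chilbert)"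
  by (metis mult_eq_0_iff norm_eq_zero norm_scaleC)

lemma norm_add_pythagoras:
  assumes "cinner x (y::'a::chilbert) = 0"
  shows "(norm (x + y))\<^sup>2 = (norm x)\<^sup>2 + (norm y)\<^sup>2"
proof -
  have "cinner (x + y) (x + y) = cinner x x + cinner y y"
    using assms cinner_eq_0_commute[of x y] by (simp add: cinner_distribs)
  then have "complex_of_real ((norm (x + y))\<^sup>2) = complex_of_real ((norm x)\<^sup>2 + (norm y)\<^sup>2)"
    by (simp only: cinner_self_norm of_real_add)
  then show ?thesis by (simp only: of_real_eq_iff)
qed

lemma clinear_simps:
  assumes "clinear f"
  shows "f (x + y) = f x + f y" "f (scaleC a x) = scaleC a (f x)" "f 0 = 0"
    "f (- x) = - f x" "f (x - y) = f x - f y"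
proof -
  show add: "f (x + y) = f x + f y" for x y using assms by (simp add: clinear_def)
  show sc: "f (scaleC a x) = scaleC a (f x)" for a x using assms by (simp add: clinear_def)
  show "f 0 = 0" using sc[of 0 0] by simp
  show minus: "f (- x) = - f x" for x using sc[of "-1" x] by simp
  show "f (x - y) = f x - f y" using add[of x "- y"] minus[of y] by simp
qed

lemma clinear_sum:
  assumes "clinear f"
  shows "f (\<Sum>i\<in>A. g i) = (\<Sum>i\<in>A. f (g i))"
  by (induction A rule: infinite_finite_induct) (simp_all add: clinear_simps[OF assms])

subsection \<open>Finite orthonormal systems\<close>

definition orthonormal :: "'a::chilbert set \<Rightarrow> bool" where
  "orthonormal E \<longleftrightarrow> (\<forall>e\<in>E. \<forall>f\<in>E. cinner e f = (if e = f then 1 else 0))"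

definition proj :: "'a::chilbert set \<Rightarrow> 'a \<Rightarrow> 'a" where
  "proj E x = (\<Sum>e\<in>E. scaleC (cinner e x) e)"

lemma clinear_proj: "clinear (proj E)"
  by (simp add: clinear_def proj_def cinner_distribs scaleC_distribs sum.distrib scaleC_sum_right)

lemmas proj_simps = clinear_simps[OF clinear_proj]

lemma cinner_proj:
  assumes "finite E" "orthonormal E" "e \<in> E"
  shows "cinner e (proj E x) = cinner e x"
proof -
  have "cinner e (proj E x) = (\<Sum>f\<in>E. if e = f then cinner f x else 0)"
    unfolding proj_def cinner_sum_right
    by (rule sum.cong) (use assms in \<open>auto simp: orthonormal_def cinner_scaleC_right\<close>)
  then show ?thesis using assms by simp
qed

lemma proj_eq_0_iff:
  assumes "finite E" "orthonormal E"
  shows "proj E x = 0 \<longleftrightarrow> (\<forall>e\<in>E. cinner e x = 0)"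
proof
  assume "proj E x = 0"
  then show "\<forall>e\<in>E. cinner e x = 0"
    using cinner_proj[OF assms, of _ x] by simp
qed (simp add: proj_def)

lemma proj_proj:
  assumes "finite E" "orthonormal E"
  shows "proj E (proj E x) = proj E x"
proof -
  have "(\<Sum>e\<in>E. scaleC (cinner e (proj E x)) e) = (\<Sum>e\<in>E. scaleC (cinner e x) e)"
    by (rule sum.cong) (simp_all add: cinner_proj[OF assms])
  then show ?thesis by (simp only: proj_def[symmetric])
qed

lemma proj_self:
  assumes "finite E" "orthonormal E" "e \<in> E"
  shows "proj E e = e"
proof -
  have "proj E e = (\<Sum>f\<in>E. if f = e then f else 0)"
    unfolding proj_def by (rule sum.cong) (use assms in \<open>auto simp: orthonormal_def\<close>)
  then show ?thesis using assms by simp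
qed

lemma cinner_proj_orth:
  assumes "proj E a = a" "\<forall>e\<in>E. cinner e x = 0"
  shows "cinner x a = 0"
proof -
  have "cinner x a = (\<Sum>e\<in>E. cinner e a * cinner x e)"
    by (subst assms(1)[symmetric]) (simp add: proj_def cinner_sum_right cinner_scaleC_right)
  then show ?thesis using assms(2) cinner_eq_0_commute by (metis (lifting) mult_zero_right sum.neutral)
qed

lemma norm_proj_le:
  assumes "finite E" "orthonormal E"
  shows "norm (proj E x) \<le> norm x"
proof -
  have "cinner (x - proj E x) (proj E x) = 0"
    by (rule cinner_proj_orth[where E = E])
      (simp_all add: proj_proj assms cinner_proj cinner_diff_right)
  then have "cinner (proj E x) (x - proj E x) = 0" by (simp only: cinner_eq_0_commute)
  from norm_add_pythagoras[OF this] have "(norm (proj E x))\<^sup>2 \<le> (norm x)\<^sup>2" by simp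
  then show ?thesis by simp
qed

lemma norm_orthonormal: "orthonormal E \<Longrightarrow> e \<in> E \<Longrightarrow> norm e = 1"
  using cinner_self_norm[of e] power2_eq_iff_nonneg[of "norm e" 1]
  by (simp add: orthonormal_def flip: of_real_power)

text \<open>For the one-element system \<open>{e}\<close>, contractivity of \<open>proj\<close> is
  the Cauchy-Schwarz inequality with a unit vector.\<close>

lemma cmod_cinner_le:
  assumes "norm e = 1"
  shows "cmod (cinner e x) \<le> norm (x::'a::chilbert)"
proof -
  have "orthonormal {e}" using assms by (simp add: orthonormal_def cinner_self_norm)
  from norm_proj_le[OF _ this] show ?thesis using assms by (simp add: proj_def)
qed

lemma csubspace_proj: "csubspace {x. proj E x = x}"
  by (simp add: csubspace_def proj_simps)

lemma csubspace_cspan: "csubspace (cspan F)"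
  unfolding cspan_def by (rule hull_in) (auto simp: csubspace_def)

lemma csubspace_sum: "csubspace M \<Longrightarrow> (\<And>i. i \<in> A \<Longrightarrow> f i \<in> M) \<Longrightarrow> (\<Sum>i\<in>A. f i) \<in> M"
  by (induction A rule: infinite_finite_induct) (auto simp: csubspace_def)

lemma csubspace_diff:
  assumes "csubspace M" "x \<in> M" "y \<in> M"
  shows "x - y \<in> M"
proof -
  have "x + scaleC (-1) y \<in> M" using assms unfolding csubspace_def by blast
  then show ?thesis by simp
qed

lemma csubspace_subspace: "csubspace M \<Longrightarrow> subspace M"
  by (auto simp: csubspace_def real_vector.subspace_def scaleR_eq_scaleC)

text \<open>In the induction the residual \<open>f - proj E f\<close> either vanishes or is
  normalised and joined to \<open>E\<close>. Fixed points of \<open>proj E\<close> stand for the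
  span of \<open>E\<close>, so that membership is an equation.\<close>

lemma gram_schmidt:
  assumes "finite (F::'a::chilbert set)"
  shows "\<exists>E. finite E \<and> orthonormal E \<and> E \<subseteq> cspan F \<and> F \<subseteq> {x. proj E x = x}"
  using assms
proof (induction F)
  case empty
  show ?case by (rule exI[of _ "{}"]) (simp add: orthonormal_def)
next
  case (insert f F)
  then obtain E where E: "finite E" "orthonormal E" "E \<subseteq> cspan F" "F \<subseteq> {x. proj E x = x}"
    by blast
  have mono: "cspan F \<subseteq> cspan (insert f F)"
    unfolding cspan_def by (rule hull_mono) blast
  define f' where "f' = f - proj E f"
  have orth: "cinner e f' = 0" if "e \<in> E" for e
    using that by (simp add: f'_def cinner_diff_right cinner_proj E)
  show ?case
  proof (cases "f' = 0")
    case True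
    then have "insert f F \<subseteq> {x. proj E x = x}" using E(4) by (simp add: f'_def)
    then show ?thesis using E mono by blast
  next
    case False
    define e where "e = scaleC (complex_of_real (1 / norm f')) f'"
    have e1: "norm e = 1" using False by (simp add: e_def norm_divide)
    have eE: "cinner x e = 0" "cinner e x = 0" if "x \<in> E" for x
    proof -
      show "cinner x e = 0" using orth[OF that] by (simp add: e_def cinner_scaleC_right)
      then show "cinner e x = 0" by (simp only: cinner_eq_0_commute)
    qed
    have ee: "cinner e e = 1" using e1 by (simp add: cinner_self_norm)
    have nE: "e \<notin> E" using eE ee by force
    have on: "orthonormal (insert e E)"
      using E(2) eE ee nE by (auto simp: orthonormal_def)
    have proj_insert: "proj (insert e E) x = scaleC (cinner e x) e + proj E x" for x
      using E(1) nE by (simp add: proj_def)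
    have cs: "csubspace (cspan (insert f F))" by (rule csubspace_cspan)
    have "proj E f \<in> cspan (insert f F)"
      unfolding proj_def
      by (rule csubspace_sum[OF cs]) (use cs E(3) mono in \<open>auto simp: csubspace_def\<close>)
    moreover have "f \<in> cspan (insert f F)" by (simp add: cspan_def hull_inc)
    ultimately have "f' \<in> cspan (insert f F)" unfolding f'_def using csubspace_diff[OF cs] by blast
    then have e_in: "e \<in> cspan (insert f F)" using cs by (simp add: e_def csubspace_def)
    have perp: "cinner e x = 0" if "proj E x = x" for x
      by (rule cinner_proj_orth[OF that]) (use eE in blast)
    have "f = proj E f + scaleC (complex_of_real (norm f')) e"
      using False by (simp add: e_def f'_def)
    then have "cinner e f = cinner e (proj E f) + complex_of_real (norm f') * cinner e e"
      by (metis cinner_add_right cinner_scaleC_right)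
    also have "\<dots> = complex_of_real (norm f')" using perp[of "proj E f"] ee by (simp add: proj_proj E)
    finally have "proj (insert e E) f = f"
      using False by (simp add: proj_insert) (simp add: e_def f'_def)
    moreover have "proj (insert e E) x = x" if "x \<in> F" for x
      using that E(4) perp[of x] by (auto simp: proj_insert)
    ultimately show ?thesis
      using E on e_in mono by (intro exI[of _ "insert e E"]) auto
  qed
qed

lemma cspan_orthonormal_basis:
  assumes "finite (F::'a::chilbert set)"
  obtains E where "finite E" "orthonormal E" "cspan F = {x. proj E x = x}"
proof -
  obtain E where E: "finite E" "orthonormal E" "E \<subseteq> cspan F" "F \<subseteq> {x. proj E x = x}"
    using gram_schmidt[OF assms] by blast
  have "cspan F \<subseteq> {x. proj E x = x}"
    unfolding cspan_def by (rule hull_minimal) (use E csubspace_proj in auto)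
  moreover have "proj E x \<in> cspan F" for x
    unfolding proj_def
    by (rule csubspace_sum[OF csubspace_cspan])
      (use E(3) csubspace_cspan[of F] in \<open>auto simp: csubspace_def\<close>)
  then have "x \<in> cspan F" if "proj E x = x" for x using that by metis
  ultimately show ?thesis using that E by blast
qed

section \<open>Dimension arguments over the reals\<close>

text \<open>The vectors \<open>e\<close> and \<open>\<i> e\<close> with \<open>e\<close> in
  \<open>E\<close> span the range over the reals, which opens the real theory of bases and dimension
  to it.\<close>

lemma proj_range_real_span:
  assumes "finite E"
  shows "\<exists>T. finite T \<and> {x. proj E x = x} \<subseteq> span T"
proof (intro exI conjI subsetI)
  show "finite (E \<union> scaleC \<i> ` E)" using assms by simp
  fix x assume "x \<in> {x. proj E x = x}"
  then have x: "x = (\<Sum>e\<in>E. scaleC (cinner e x) e)" by (simp add: proj_def)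
  have "scaleC c e \<in> span (E \<union> scaleC \<i> ` E)" if "e \<in> E" for c e
  proof -
    have "scaleC c e = Re c *\<^sub>R e + Im c *\<^sub>R scaleC \<i> e"
      by (simp add: scaleR_eq_scaleC flip: scaleC_add_left)
        (metis complex_eq mult.commute)
    then show ?thesis
      using that by (simp add: real_vector.span_add real_vector.span_base real_vector.span_scale)
  qed
  then have "(\<Sum>e\<in>E. scaleC (cinner e x) e) \<in> span (E \<union> scaleC \<i> ` E)"
    by (intro real_vector.span_sum)
  then show "x \<in> span (E \<union> scaleC \<i> ` E)" using x by metis
qed

lemma finite_dim_subspace_basis:
  fixes V :: "'a::real_vector set"
  assumes "V \<subseteq> span T" "finite T"
  obtains B where "finite B" "independent B" "B \<subseteq> V" "V \<subseteq> span B"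
proof -
  obtain B where "B \<subseteq> V" "independent B" "V \<subseteq> span B"
    using real_vector.basis_exists by metis
  moreover from this have "finite B"
    using real_vector.independent_span_bound[of T B] assms by blast
  ultimately show ?thesis using that by blast
qed

text \<open>\<open>A\<close> is finite-dimensional and so has an orthonormal basis \<open>D\<close>
  of its own. For \<open>x\<close> in the range of \<open>proj E\<close>, the residual
  \<open>x - proj D x\<close> stays in that range and is orthogonal to \<open>A\<close>, hence
  zero.\<close>

lemma csubspace_eq_of_orth_trivial:
  assumes E: "finite E" "orthonormal E"
    and A: "csubspace A" "A \<subseteq> {x. proj E x = x}"
    and triv: "\<And>x. proj E x = x \<Longrightarrow> \<forall>a\<in>A. cinner a x = 0 \<Longrightarrow> x = 0"
  shows "A = {x. proj E x = x}"
proof -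
  obtain T where "finite T" "{x. proj E x = x} \<subseteq> span T"
    using proj_range_real_span[OF E(1)] by blast
  with A(2) obtain G where G: "finite G" "G \<subseteq> A" "A \<subseteq> span G"
    using finite_dim_subspace_basis[of A T] by (metis subset_trans)
  have "span G \<subseteq> cspan G"
    by (rule real_vector.span_minimal)
      (use csubspace_cspan csubspace_subspace in \<open>auto simp: cspan_def hull_inc\<close>)
  moreover have "cspan G \<subseteq> A" unfolding cspan_def by (rule hull_minimal) (use G A in auto)
  ultimately have "A = cspan G" using G by blast
  then obtain D where D: "finite D" "orthonormal D" "A = {x. proj D x = x}"
    using cspan_orthonormal_basis[OF G(1)] by metis
  have "x \<in> A" if x: "proj E x = x" for x
  proof -
    have "proj D x \<in> A" using D by (simp add: proj_proj)
    then have "proj E (x - proj D x) = x - proj D x" using x A(2) by (auto simp: proj_simps)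
    moreover have "cinner a (x - proj D x) = 0" if "a \<in> A" for a
    proof -
      have "cinner (x - proj D x) a = 0"
        by (rule cinner_proj_orth[where E = D])
          (use that D in \<open>auto simp: cinner_proj cinner_diff_right\<close>)
      then show ?thesis by (simp only: cinner_eq_0_commute)
    qed
    ultimately have "x - proj D x = 0" using triv by blast
    then show ?thesis using D by simp
  qed
  then show ?thesis using A(2) by blast
qed

text \<open>A dimension count: a linear selection \<open>f\<close> of \<open>L\<close> is injective
  by \<open>ker\<close>, and a nonzero \<open>b\<close> would lie outside its image, giving more
  independent vectors in \<open>span B\<close> than \<open>B\<close> has elements.\<close>

lemma finite_dim_relation_inj:
  fixes L :: "('a::real_vector \<times> 'a) set"
  assumes L: "subspace L" and W: "W \<subseteq> span T" "finite T"
    and dom: "W \<subseteq> fst ` L" and ran: "snd ` L \<subseteq> W"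
    and ker: "\<And>a. (a, 0) \<in> L \<Longrightarrow> a = 0"
    and b: "(0, b) \<in> L"
  shows "b = 0"
proof (rule ccontr)
  assume "b \<noteq> 0"
  obtain B where B: "finite B" "independent B" "B \<subseteq> W" "W \<subseteq> span B"
    using finite_dim_subspace_basis[OF W] by blast
  have "\<forall>x\<in>B. \<exists>y. (x, y) \<in> L" using B(3) dom by force
  then obtain g where g: "\<And>x. x \<in> B \<Longrightarrow> (x, g x) \<in> L" by metis
  obtain f where f: "linear f" "\<And>x. x \<in> B \<Longrightarrow> f x = g x"
    using linear_independent_extend[OF B(2)] by metis
  have fL: "(x, f x) \<in> L" if "x \<in> span B" for x
    using that
  proof (induction rule: real_vector.span_induct_alt)
    case base
    then show ?case using L f(1) by (simp add: real_vector.subspace_def linear_0 flip: zero_prod_def)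
  next
    case (step c x y)
    have "c *\<^sub>R (x, f x) + (y, f y) \<in> L"
      using L step g f(2) unfolding real_vector.subspace_def by metis
    then show ?case using f(1) by (simp add: linear_add linear_scale)
  qed
  have "inj_on f (span B)"
    unfolding linear_injective_on_subspace_0[OF f(1) real_vector.subspace_span]
    using fL ker by metis
  then have ind: "independent (f ` B)"
    using linear_independent_injective_image[OF f(1) B(2)] by blast
  have nb: "b \<notin> span (f ` B)"
  proof
    assume "b \<in> span (f ` B)"
    then obtain x where x: "x \<in> span B" "b = f x"
      using linear_span_image[OF f(1)] by blast
    have "(x, f x) - (0, b) \<in> L"
      using L fL[OF x(1)] b by (rule real_vector.subspace_diff)
    then have "x = 0" using x(2) ker by simp
    then show False using \<open>b \<noteq> 0\<close> x(2) f(1) linear_0 by blast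
  qed
  have "independent (insert b (f ` B))"
    using ind nb by (simp add: real_vector.independent_insert)
  moreover have "insert b (f ` B) \<subseteq> span B"
  proof -
    have "b \<in> W" using b ran by force
    moreover have "f x \<in> W" if "x \<in> B" for x
      using fL[OF real_vector.span_base[OF that]] ran by force
    ultimately show ?thesis using B(4) by blast
  qed
  ultimately have "card (insert b (f ` B)) \<le> card B"
    using real_vector.independent_span_bound B(1) by blast
  moreover have "card (f ` B) = card B"
    using \<open>inj_on f (span B)\<close> card_image inj_on_subset real_vector.span_superset by metis
  moreover have "b \<notin> f ` B" using nb real_vector.span_superset[of "f ` B"] by blast
  ultimately show False using B(1) by simp
qed

subsection \<open>Extensions of the partial isometry\<close>

text \<open>The relation \<open>C\<close> plays the role of the Cayley transform of the extension. Membership of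
  \<open>(p, q)\<close> in \<open>C\<close> forces \<open>p = a + h\<close>, \<open>q = U (b + h)\<close> with \<open>a\<close>, \<open>b\<close> in the wandering
  subspace and \<open>h\<close> orthogonal to it; \<open>C_dec\<close> encodes this as \<open>b - a = U\<^sup>-\<^sup>1 q - p\<close>. Thus \<open>C\<close> is
  determined by the pairs \<open>(a, b)\<close>.\<close>

locale shift_relation =
  fixes U U' :: "'h::chilbert \<Rightarrow> 'h" and E :: "'h set" and C :: "('h \<times> 'h) set"
    and J :: "'h \<Rightarrow> 'h"
  assumes linU: "clinear U" and linU': "clinear U'"
    and UU' [simp]: "U (U' x) = x" and U'U [simp]: "U' (U x) = x"
    and cinner_U [simp]: "cinner (U x) (U y) = cinner x y"
    and finE: "finite E" and onE: "orthonormal E"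
    and wander: "e \<in> E \<Longrightarrow> f \<in> E \<Longrightarrow> cinner e ((U ^^ Suc k) f) = 0"
    and C_zero: "(0, 0) \<in> C"
    and C_add: "(x, y) \<in> C \<Longrightarrow> (u, v) \<in> C \<Longrightarrow> (x + u, y + v) \<in> C"
    and C_scale: "(x, y) \<in> C \<Longrightarrow> (scaleC c x, scaleC c y) \<in> C"
    and C_ext: "proj E h = 0 \<Longrightarrow> (h, U h) \<in> C"
    and C_dec: "(p, q) \<in> C \<Longrightarrow> proj E (U' q - p) = U' q - p"
    and C_max: "(\<And>p q. (p, q) \<in> C \<Longrightarrow> cinner p p' = cinner q q') \<Longrightarrow> (J p', J q') \<in> C"
    and J_zero_iff [simp]: "J x = 0 \<longleftrightarrow> x = 0"
begin

lemmas U_simps = clinear_simps[OF linU] clinear_simps[OF linU']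

lemma norm_U [simp]: "norm (U x) = norm x"
  by (rule norm_eq_of_cinner_eq) simp

lemma cinner_U' [simp]: "cinner (U' x) (U' y) = cinner x y"
  using cinner_U[of "U' x" "U' y"] by simp

lemma C_diff: "(x, y) \<in> C \<Longrightarrow> (u, v) \<in> C \<Longrightarrow> (x - u, y - v) \<in> C"
  using C_add[OF _ C_scale[of u v "-1"]] by force

lemma clinear_funpow: "clinear (U ^^ k)"
  using linU by (induction k) (simp_all add: clinear_def)

lemma norm_funpow [simp]: "norm ((U ^^ k) x) = norm x"
  by (induction k) simp_all

lemma funpow_U: "(U ^^ k) (U x) = (U ^^ Suc k) x"
  by (simp add: funpow_swap1)

lemma proj_U: "proj (U ` E) (U x) = U (proj E x)"
proof -
  have "inj_on U E" by (metis U'U inj_onI)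
  then show ?thesis
    by (simp add: proj_def sum.reindex clinear_sum[OF linU] U_simps)
qed

text \<open>Reversing \<open>p = a + h\<close>, \<open>q = U (b + h)\<close> gives
  \<open>q = U b + U h\<close>, \<open>p = U' (U a + U h)\<close>: the same shape for
  \<open>U'\<close>, with \<open>a\<close> and \<open>b\<close> exchanged and the wandering subspace
  moved by \<open>U\<close>. Results of the locale thus carry over to the lower half plane.\<close>

lemma converse_shift_relation: "shift_relation U' U (U ` E) (C\<inverse>) J"
proof
  have projU': "proj (U ` E) x = U (proj E (U' x))" for x
    using proj_U[of "U' x"] by simp
  show "orthonormal (U ` E)"
    using onE by (auto simp: orthonormal_def) (metis U'U)
  show "cinner e ((U' ^^ Suc k) f) = 0" if "e \<in> U ` E" "f \<in> U ` E" for e f k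
  proof -
    obtain e0 f0 where e0: "e0 \<in> E" "e = U e0" and f0: "f0 \<in> E" "f = U f0"
      using \<open>e \<in> U ` E\<close> \<open>f \<in> U ` E\<close> by blast
    have "cinner ((U ^^ k) x) y = cinner x ((U' ^^ k) y)" for x y
    proof (induction k arbitrary: x y)
      case (Suc k)
      have "cinner (U ((U ^^ k) x)) y = cinner ((U ^^ k) x) (U' y)"
        using cinner_U[of _ "U' y"] by simp
      then show ?case using Suc by (simp add: funpow_swap1)
    qed simp
    from this[where y = "U' f"] have "cinner e ((U' ^^ Suc k) f) = cinner ((U ^^ Suc k) e0) f0"
      using e0(2) f0(2) by (simp add: funpow_swap1)
    also have "\<dots> = 0" using wander[OF f0(1) e0(1)] by (simp only: cinner_eq_0_commute)
    finally show ?thesis .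
  qed
  show "(h, U' h) \<in> C\<inverse>" if "proj (U ` E) h = 0" for h
  proof -
    have "proj E (U' h) = 0" using that projU' by (metis U'U U_simps(8))
    from C_ext[OF this] show ?thesis by simp
  qed
  show "proj (U ` E) (U q - p) = U q - p" if "(p, q) \<in> C\<inverse>" for p q
  proof -
    have "proj E (U' p - q) = U' p - q" using that C_dec by blast
    then have "proj E (q - U' p) = q - U' p" by (metis minus_diff_eq proj_simps(4))
    then show ?thesis by (simp add: projU' U_simps)
  qed
  show "(J p', J q') \<in> C\<inverse>"
    if "\<And>p q. (p, q) \<in> C\<inverse> \<Longrightarrow> cinner p p' = cinner q q'" for p' q'
    using C_max[of q' p'] that by fastforce
qed (use finE C_zero C_add C_scale linU linU' in auto)

lemma wander_proj:
  assumes "e \<in> E" "proj E w = w"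
  shows "cinner e ((U ^^ Suc k) w) = 0"
proof -
  have "(U ^^ Suc k) w = (\<Sum>f\<in>E. scaleC (cinner f w) ((U ^^ Suc k) f))"
    by (subst assms(2)[symmetric]) (simp only: proj_def clinear_sum[OF clinear_funpow]
        clinear_simps[OF clinear_funpow])
  then show ?thesis
    using assms(1) wander by (simp only: cinner_sum_right cinner_scaleC_right) simp
qed

section \<open>Inversion of \<open>1 - \<epsilon> U\<close> inside the unit disc\<close>

text \<open>A solution is a fixed point of \<open>r \<mapsto> g + \<epsilon> U r\<close>, a
  contraction with constant \<open>cmod \<epsilon>\<close> because \<open>U\<close> is
  isometric.\<close>

lemma neumann_exists:
  assumes "cmod \<epsilon> < 1"
  obtains r where "r - scaleC \<epsilon> (U r) = g"
proof -
  have "\<exists>!r. g + scaleC \<epsilon> (U r) = r"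
  proof (rule banach_fix_type[where c = "cmod \<epsilon>"])
    show "\<forall>x y. dist (g + scaleC \<epsilon> (U x)) (g + scaleC \<epsilon> (U y)) \<le> cmod \<epsilon> * dist x y"
      by (simp add: dist_norm flip: scaleC_diff_right U_simps(5))
  qed (use assms in simp_all)
  then obtain r where "g + scaleC \<epsilon> (U r) = r" by blast
  then show ?thesis by (metis add_diff_cancel_right' that)
qed

lemma neumann_bound: "(1 - cmod \<epsilon>) * norm r \<le> norm (r - scaleC \<epsilon> (U r))"
  using norm_triangle_ineq2[of r "scaleC \<epsilon> (U r)"] by (simp add: algebra_simps)

text \<open>Formally \<open>r\<close> is the sum of \<open>\<epsilon>^k U^k w\<close> over
  \<open>k \<ge> 1\<close>, whose terms are all orthogonal to \<open>E\<close> by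
  \<open>wander_proj\<close>. The proof iterates the equation for \<open>r\<close> instead of
  summing.\<close>

lemma neumann_orth:
  assumes \<epsilon>: "cmod \<epsilon> < 1" and w: "proj E w = w" and r: "r - scaleC \<epsilon> (U r) = scaleC \<epsilon> (U w)"
  shows "proj E r = 0"
proof -
  have "cinner e r = 0" if e: "e \<in> E" for e
  proof -
    have step: "cinner e ((U ^^ k) r) = \<epsilon> * cinner e ((U ^^ Suc k) r)" for k
    proof -
      have "r = scaleC \<epsilon> (U r) + scaleC \<epsilon> (U w)" using r by (simp add: algebra_simps)
      then have "(U ^^ k) r = scaleC \<epsilon> ((U ^^ Suc k) r) + scaleC \<epsilon> ((U ^^ Suc k) w)"
        by (metis clinear_simps(1,2)[OF clinear_funpow] funpow_U)
      then show ?thesis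
        using wander_proj[OF e w, of k] by (simp only: cinner_distribs) simp
    qed
    have pow: "cinner e r = \<epsilon> ^ k * cinner e ((U ^^ k) r)" for k
    proof (induction k)
      case (Suc k)
      then show ?case using step[of k] by (metis mult.assoc power_Suc2)
    qed simp
    \<comment> \<open>By \<open>pow\<close> the inner product is \<open>\<epsilon> ^ k\<close> times
      a quantity bounded by \<open>norm r\<close>, for every \<open>k\<close>, so it vanishes in the
      limit.\<close>
    have "cmod (cinner e r) \<le> cmod \<epsilon> ^ k * norm r" for k
      using cmod_cinner_le[OF norm_orthonormal[OF onE e], of "(U ^^ k) r"]
      by (subst pow[of k]) (simp add: norm_mult norm_power mult_left_mono)
    moreover have "(\<lambda>k. cmod \<epsilon> ^ k * norm r) \<longlonglongrightarrow> 0"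
      using \<epsilon> by (intro tendsto_mult_left_zero LIMSEQ_realpow_zero) simp_all
    ultimately have "cmod (cinner e r) \<le> 0" by (intro LIMSEQ_le_const) auto
    then show ?thesis by simp
  qed
  then show ?thesis by (simp add: proj_eq_0_iff[OF finE onE])
qed

section \<open>Kernel and inverse of the pencil \<open>p - \<epsilon> q\<close>\<close>

text \<open>Subtracting \<open>(h, U h)\<close> with \<open>h = p - proj E p\<close> leaves the
  finite-dimensional part \<open>(a, U b)\<close> of the pair, where
  \<open>a = proj E p\<close>.\<close>

lemma C_reduce:
  assumes "(p, q) \<in> C"
  shows "(proj E p, U (proj E p + (U' q - p))) \<in> C"
    and "proj E (proj E p + (U' q - p)) = proj E p + (U' q - p)"
proof -
  have "proj E (p - proj E p) = 0" by (simp add: proj_simps proj_proj finE onE)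
  from C_diff[OF assms C_ext[OF this]]
  show "(proj E p, U (proj E p + (U' q - p))) \<in> C" by (simp add: U_simps algebra_simps)
  show "proj E (proj E p + (U' q - p)) = proj E p + (U' q - p)"
    using C_dec[OF assms] by (simp add: proj_simps(1) proj_proj finE onE)
qed

lemma C_fst_zero:
  assumes "(0, q) \<in> C"
  shows "proj E (U' q) = U' q"
  using C_dec[OF assms] by (simp add: proj_simps U_simps)

text \<open>By \<open>C_max\<close>, a vector of the wandering subspace orthogonal to all first components would
  yield an element of \<open>C\<close> with zero second component.\<close>

lemma total:
  assumes triv: "\<And>a. (a, 0) \<in> C \<Longrightarrow> a = 0" and x: "proj E x = x"
  obtains b where "proj E b = b" "(x, U b) \<in> C"
proof -
  let ?A = "{a. proj E a = a \<and> (\<exists>b. proj E b = b \<and> (a, U b) \<in> C)}"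
  have "?A = {a. proj E a = a}"
  proof (rule csubspace_eq_of_orth_trivial[OF finE onE])
    show "csubspace ?A"
      unfolding csubspace_def
    proof (intro conjI ballI allI)
      show "0 \<in> ?A" using C_zero by (auto simp: proj_simps U_simps intro: exI[of _ 0])
      show "x + y \<in> ?A" if x: "x \<in> ?A" and y: "y \<in> ?A" for x y
      proof -
        obtain b c where "proj E b = b" "(x, U b) \<in> C" "proj E c = c" "(y, U c) \<in> C"
          using x y by blast
        then have "proj E (b + c) = b + c" "(x + y, U (b + c)) \<in> C"
          using C_add by (simp_all add: proj_simps U_simps)
        then show ?thesis using x y unfolding mem_Collect_eq by (metis proj_simps(1))
      qed
      show "scaleC c x \<in> ?A" if x: "x \<in> ?A" for c x
      proof -
        obtain b where "proj E b = b" "(x, U b) \<in> C" using x by blast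
        then have "proj E (scaleC c b) = scaleC c b" "(scaleC c x, U (scaleC c b)) \<in> C"
          using C_scale by (simp_all add: proj_simps U_simps)
        then show ?thesis using x unfolding mem_Collect_eq by (metis proj_simps(2))
      qed
    qed
    show "y = 0" if y: "proj E y = y" and orth: "\<forall>a\<in>?A. cinner a y = 0" for y
    proof -
      \<comment> \<open>The premise of \<open>C_max\<close> for the pair \<open>(y, 0)\<close>:
        \<open>proj E p\<close> lies in \<open>?A\<close>, and the rest of \<open>p\<close> is
        orthogonal to the whole wandering subspace, which contains \<open>y\<close>.\<close>
      have "cinner p y = cinner q 0" if pq: "(p, q) \<in> C" for p q
      proof -
        have "proj E p \<in> ?A" using C_reduce[OF pq] by (auto simp: proj_proj finE onE)
        then have "cinner (proj E p) y = 0" using orth by blast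
        moreover have "cinner (p - proj E p) y = 0"
          by (rule cinner_proj_orth[OF y])
            (simp add: cinner_diff_right cinner_proj finE onE)
        ultimately show ?thesis by (simp add: cinner_diff_left)
      qed
      from C_max[OF this] have "(J y, J 0) \<in> C" by blast
      moreover have "J 0 = 0" by simp
      ultimately show ?thesis using triv[of "J y"] by simp
    qed
  qed blast
  then show ?thesis using that x by blast
qed

text \<open>By \<open>total\<close> every vector of the wandering subspace is a first component of
  \<open>?L\<close>, so \<open>finite_dim_relation_inj\<close> applies. Used for \<open>C\<close>
  and for its converse, this makes the two conditions equivalent.\<close>

lemma snd_zero_trivial_imp:
  assumes triv: "\<And>a. (a, 0) \<in> C \<Longrightarrow> a = 0" and b: "(0, b) \<in> C"
  shows "b = 0"
proof -
  let ?W = "{x. proj E x = x}"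
  let ?L = "{(a, b). a \<in> ?W \<and> b \<in> ?W \<and> (a, U b) \<in> C}"
  obtain T where T: "finite T" "?W \<subseteq> span T" using proj_range_real_span[OF finE] by blast
  have "U' b = 0"
  proof (rule finite_dim_relation_inj)
    show "subspace ?L"
      using C_zero C_add C_scale
      by (auto simp: real_vector.subspace_def proj_simps U_simps scaleR_eq_scaleC zero_prod_def)
    show "?W \<subseteq> fst ` ?L"
    proof
      fix x assume x: "x \<in> ?W"
      obtain b where "proj E b = b" "(x, U b) \<in> C" using total[OF triv, of x] x by blast
      then have "(x, b) \<in> ?L" using x by blast
      then show "x \<in> fst ` ?L" by force
    qed
    show "a = 0" if "(a, 0) \<in> ?L" for a using that triv by (simp add: U_simps)
    show "(0, U' b) \<in> ?L" using b C_fst_zero[OF b] by (simp add: proj_simps)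
  qed (use T in auto)
  then show ?thesis using UU'[of b] by (simp add: U_simps)
qed

text \<open>The solution of \<open>r - \<epsilon> U r = \<epsilon> b\<close> is orthogonal to the
  wandering subspace, so \<open>(r, U r)\<close> may be added to \<open>(0, b)\<close>; then
  \<open>q = U r + b\<close> satisfies \<open>r = \<epsilon> q\<close>.\<close>

lemma eigen_exists:
  assumes b: "(0, b) \<in> C" "b \<noteq> 0" and \<epsilon>: "cmod \<epsilon> < 1"
  obtains q where "q \<noteq> 0" "(scaleC \<epsilon> q, q) \<in> C"
proof -
  obtain r where r: "r - scaleC \<epsilon> (U r) = scaleC \<epsilon> b" using neumann_exists[OF \<epsilon>] by blast
  have "proj E r = 0" by (rule neumann_orth[OF \<epsilon> C_fst_zero[OF b(1)]]) (simp add: r)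
  from C_add[OF C_ext[OF this] b(1)] have "(r, U r + b) \<in> C" by simp
  moreover have "r = scaleC \<epsilon> (U r + b)" using r by (simp add: scaleC_add_right algebra_simps)
  moreover have "U r + b \<noteq> 0"
  proof
    assume "U r + b = 0"
    then have "r = 0" using \<open>r = scaleC \<epsilon> (U r + b)\<close> by simp
    then show False using \<open>U r + b = 0\<close> b(2) by (simp add: U_simps)
  qed
  ultimately show ?thesis using that by metis
qed

text \<open>Both parts compare with the unrestricted solution of
  \<open>r - \<epsilon> U r = g\<close>, which needs only a finite-dimensional correction. The bound
  is on \<open>q - p\<close> because under the Cayley transform this is \<open>2 \<i> x\<close> for
  the domain vector \<open>x\<close>.\<close>

lemma regular:
  assumes triv: "\<And>a. (a, 0) \<in> C \<Longrightarrow> a = 0" and \<epsilon>: "cmod \<epsilon> < 1"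
  shows "\<exists>p q. (p, q) \<in> C \<and> p - scaleC \<epsilon> q = g"
    and "\<exists>K. \<forall>(p, q)\<in>C. norm (q - p) \<le> K * norm (p - scaleC \<epsilon> q)"
proof -
  obtain r where r: "r - scaleC \<epsilon> (U r) = g" using neumann_exists[OF \<epsilon>] by blast
  define a where "a = proj E r"
  have a: "proj E a = a" by (simp add: a_def proj_proj finE onE)
  obtain b where b: "proj E b = b" "(a, U b) \<in> C" using total[OF triv a] by blast
  \<comment> \<open>The component \<open>a\<close> may keep \<open>(r, U r)\<close> out of
    \<open>C\<close>. Replacing \<open>(a, U a)\<close> by \<open>(a, U b)\<close> changes the
    pencil by \<open>- \<epsilon> U (b - a)\<close>, which \<open>s\<close> compensates while
    staying orthogonal to \<open>E\<close>.\<close>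
  obtain s where s: "s - scaleC \<epsilon> (U s) = scaleC \<epsilon> (U (b - a))"
    using neumann_exists[OF \<epsilon>] by blast
  have ba: "proj E (b - a) = b - a" using a b by (simp add: proj_simps)
  have s0: "proj E s = 0" by (rule neumann_orth[OF \<epsilon> ba s])
  have "proj E (r + s - a) = 0" using s0 a by (simp add: proj_simps) (simp add: a_def)
  from C_add[OF C_ext[OF this] b(2)] have "(r + s, U (r + s - a) + U b) \<in> C" by simp
  moreover have "r + s - scaleC \<epsilon> (U (r + s - a) + U b)
      = (r - scaleC \<epsilon> (U r)) + (s - scaleC \<epsilon> (U s)) - scaleC \<epsilon> (U (b - a))"
    by (simp add: U_simps scaleC_distribs)
  ultimately show "\<exists>p q. (p, q) \<in> C \<and> p - scaleC \<epsilon> q = g" using r s by auto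
next
  have "\<forall>e\<in>E. \<exists>b. (e, b) \<in> C"
    using total[OF triv] proj_self[OF finE onE] by metis
  then obtain t where t: "\<And>e. e \<in> E \<Longrightarrow> (e, t e) \<in> C" by metis
  define M where "M = (\<Sum>e\<in>E. norm (t e))"
  have M: "norm b \<le> M * norm a" if a: "proj E a = a" and b: "(a, b) \<in> C" for a b
  proof -
    have "((\<Sum>e\<in>F. scaleC (cinner e a) e), (\<Sum>e\<in>F. scaleC (cinner e a) (t e))) \<in> C"
      if "F \<subseteq> E" for F
      using finite_subset[OF that finE] that
      by (induction F) (simp_all add: C_zero C_add C_scale t)
    from this[of E] a have "(a, \<Sum>e\<in>E. scaleC (cinner e a) (t e)) \<in> C" by (simp add: proj_def)
    \<comment> \<open>\<open>C\<close> is single-valued, so the combination of the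
      \<open>t e\<close> is the only possible partner of \<open>a\<close>.\<close>
    from C_diff[OF b this] have "b = (\<Sum>e\<in>E. scaleC (cinner e a) (t e))"
      using snd_zero_trivial_imp[OF triv] by fastforce
    then have "norm b \<le> (\<Sum>e\<in>E. cmod (cinner e a) * norm (t e))"
      by (metis (no_types, lifting) norm_scaleC norm_sum sum.cong)
    also have "\<dots> \<le> (\<Sum>e\<in>E. norm a * norm (t e))"
      by (intro sum_mono mult_right_mono cmod_cinner_le norm_orthonormal[OF onE]) simp_all
    finally show ?thesis by (simp add: M_def sum_distrib_left mult.commute)
  qed
  define c where "c = 1 / (1 - cmod \<epsilon>)"
  have c: "norm x \<le> c * norm (x - scaleC \<epsilon> (U x))" for x
    using neumann_bound[of \<epsilon> x] \<epsilon> by (simp add: c_def field_simps)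
  have c0: "0 \<le> c" using \<epsilon> by (simp add: c_def)
  have M0: "0 \<le> M" by (simp add: M_def sum_nonneg)
  have "norm (q - p) \<le> (2 * (c + c * ((M + 1) * c)) + (M + 1) * c) * norm (p - scaleC \<epsilon> q)"
    if pq: "(p, q) \<in> C" for p q
  proof -
    define g where "g = p - scaleC \<epsilon> q"
    define a where "a = proj E p"
    define d where "d = U' q - p"
    have q: "q = U p + U d" by (simp add: d_def U_simps)
    have ad: "(a, U (a + d)) \<in> C" using C_reduce(1)[OF pq] by (simp add: a_def d_def)
    obtain r where r: "r - scaleC \<epsilon> (U r) = g" using neumann_exists[OF \<epsilon>] by blast
    \<comment> \<open>As \<open>p - r\<close> solves the equation with right-hand side
      \<open>\<epsilon> U d\<close>, it is orthogonal to \<open>E\<close>. Hence \<open>a\<close> is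
      controlled by \<open>r\<close> and so by \<open>g\<close>; bounds for \<open>d\<close>,
      \<open>p\<close> and \<open>q\<close> follow in turn.\<close>
    have "proj E (p - r) = 0"
    proof (rule neumann_orth[OF \<epsilon> C_dec[OF pq]])
      have "p - r - scaleC \<epsilon> (U (p - r)) = (p - scaleC \<epsilon> (U p)) - (r - scaleC \<epsilon> (U r))"
        by (simp add: U_simps scaleC_distribs)
      also have "\<dots> = scaleC \<epsilon> (U d)" unfolding r g_def q by (simp add: scaleC_distribs)
      finally show "p - r - scaleC \<epsilon> (U (p - r)) = scaleC \<epsilon> (U (U' q - p))" by (simp add: d_def)
    qed
    then have "a = proj E r" by (simp add: proj_simps a_def)
    then have "norm a \<le> norm r" using norm_proj_le[OF finE onE] by simp
    also have nr: "norm r \<le> c * norm g" using c[of r] r by simp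
    finally have na: "norm a \<le> c * norm g" .
    have "norm (U (a + d)) \<le> M * norm a"
      by (rule M[OF _ ad]) (simp add: a_def proj_proj finE onE)
    then have "norm d \<le> M * norm a + norm a"
      using norm_triangle_ineq4[of "a + d" a] by simp
    also have "\<dots> = (M + 1) * norm a" by (simp add: algebra_simps)
    also have "\<dots> \<le> (M + 1) * (c * norm g)" using na M0 by (intro mult_left_mono) simp_all
    finally have nd: "norm d \<le> (M + 1) * c * norm g" by (simp add: mult.assoc)
    have "p - scaleC \<epsilon> (U p) = g + scaleC \<epsilon> (U d)" by (simp add: g_def q scaleC_distribs)
    then have "norm p \<le> c * norm (g + scaleC \<epsilon> (U d))" using c[of p] by simp
    also have "\<dots> \<le> c * (norm g + norm d)"
    proof (rule mult_left_mono[OF _ c0])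
      have "cmod \<epsilon> * norm d \<le> norm d" using \<epsilon> by (simp add: mult_left_le_one_le)
      then show "norm (g + scaleC \<epsilon> (U d)) \<le> norm g + norm d"
        using norm_triangle_ineq[of g "scaleC \<epsilon> (U d)"] by simp
    qed
    also have "\<dots> \<le> c * (norm g + (M + 1) * c * norm g)"
      using nd c0 by (intro mult_left_mono) simp_all
    finally have np: "norm p \<le> (c + c * ((M + 1) * c)) * norm g" by (simp add: algebra_simps)
    have "norm (q - p) \<le> norm q + norm p" by (rule norm_triangle_ineq4)
    also have "norm q \<le> norm p + norm d" unfolding q by (metis norm_U norm_triangle_ineq)
    finally have "norm (q - p) \<le> 2 * norm p + norm d" by simp
    also have "\<dots> \<le> 2 * ((c + c * ((M + 1) * c)) * norm g) + (M + 1) * c * norm g"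
      using np nd by linarith
    finally show ?thesis by (simp add: g_def[symmetric] distrib_right mult.assoc)
  qed
  then show "\<exists>K. \<forall>(p, q)\<in>C. norm (q - p) \<le> K * norm (p - scaleC \<epsilon> q)" by blast
qed

text \<open>On the unit circle the partial orbit sums \<open>p n = \<epsilon> U e + \<dots> + \<epsilon>\<^sup>n U\<^sup>n e\<close> are orthogonal to
  the wandering subspace and grow in norm, while \<open>p n - \<epsilon> U (p n)\<close> telescopes.\<close>

lemma not_bounded_below:
  assumes \<epsilon>: "cmod \<epsilon> = 1" and e: "e \<in> E"
  shows "\<nexists>K. \<forall>h. proj E h = 0 \<longrightarrow> norm h \<le> K * norm (h - scaleC \<epsilon> (U h))"
proof
  assume "\<exists>K. \<forall>h. proj E h = 0 \<longrightarrow> norm h \<le> K * norm (h - scaleC \<epsilon> (U h))"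
  then obtain K where K: "\<And>h. proj E h = 0 \<Longrightarrow> norm h \<le> K * norm (h - scaleC \<epsilon> (U h))" by blast
  have ne: "norm e = 1" using norm_orthonormal[OF onE e] .
  define p where "p n = ((\<lambda>x. scaleC \<epsilon> (U (x + e))) ^^ n) 0" for n :: nat
  have p0: "p 0 = 0" and pS: "p (Suc n) = scaleC \<epsilon> (U (p n + e))" for n
    by (simp_all add: p_def)
  \<comment> \<open>The claim covers all \<open>k\<close> because one step of the recursion turns
    \<open>k\<close> into \<open>Suc k\<close>.\<close>
  have orth: "cinner f ((U ^^ k) (p n)) = 0" if f: "f \<in> E" for f k n
  proof (induction n arbitrary: k)
    case 0
    show ?case by (simp add: p0 clinear_simps[OF clinear_funpow])
  next
    case (Suc n)
    have "(U ^^ k) (p (Suc n)) = scaleC \<epsilon> ((U ^^ Suc k) (p n) + (U ^^ Suc k) e)"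
      by (simp only: pS clinear_simps[OF clinear_funpow] funpow_U)
    then show ?case
      using Suc[of "Suc k"] wander[OF f e, of k]
      by (simp only: cinner_scaleC_right cinner_add_right) simp
  qed
  have perp: "proj E (p n) = 0" for n
    using orth[of _ 0 n] by (simp add: proj_eq_0_iff finE onE)
  have norm_p: "(norm (p n))\<^sup>2 = real n" for n
  proof (induction n)
    case (Suc n)
    have "cinner (p n) e = 0" using orth[OF e, of 0 n] by (simp add: cinner_eq_0_commute)
    from norm_add_pythagoras[OF this] show ?case using Suc \<epsilon> ne by (simp add: pS)
  qed (simp add: p0)
  \<comment> \<open>The vector inside the norm is \<open>- \<epsilon>^(n+1) U^(n+1) e\<close>, the
    end term left by telescoping.\<close>
  have tele: "norm (p n - scaleC \<epsilon> (U (p n)) - scaleC \<epsilon> (U e)) = 1" for n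
  proof (induction n)
    case (Suc n)
    have "p (Suc n) - scaleC \<epsilon> (U (p (Suc n))) - scaleC \<epsilon> (U e)
        = scaleC \<epsilon> (U (p n - scaleC \<epsilon> (U (p n)) - scaleC \<epsilon> (U e)))"
      by (simp add: pS U_simps scaleC_distribs)
    then show ?case using Suc \<epsilon> by simp
  qed (use \<epsilon> ne in \<open>simp add: p0 U_simps\<close>)
  have D: "norm (p n - scaleC \<epsilon> (U (p n))) \<le> 2" for n
    using norm_triangle_sub[of "p n - scaleC \<epsilon> (U (p n))" "scaleC \<epsilon> (U e)"] tele[of n] \<epsilon> ne by simp
  have "real n \<le> (\<bar>K\<bar> * 2)\<^sup>2" for n
  proof -
    have "norm (p n) \<le> \<bar>K\<bar> * norm (p n - scaleC \<epsilon> (U (p n)))"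
      using K[OF perp[of n]] by (rule order_trans) (simp add: mult_right_mono)
    also have "\<dots> \<le> \<bar>K\<bar> * 2" using D by (intro mult_left_mono) simp_all
    finally show ?thesis using norm_p[of n] by (metis norm_ge_zero power_mono)
  qed
  then show False using reals_Archimedean2[of "(\<bar>K\<bar> * 2)\<^sup>2"] by (metis not_le)
qed

end

subsection \<open>Cayley transform and spectrum\<close>

text \<open>The Cayley transform, as a relation since \<open>B - \<i>\<close> may fail to be
  injective. On the Phillips operator it returns the graph of \<open>U\<close> on
  \<open>orth W0\<close>.\<close>

definition cay :: "('a::chilbert \<times> 'a) set \<Rightarrow> ('a \<times> 'a) set" where
  "cay B = {(w - scaleC \<i> x, w + scaleC \<i> x) | x w. (x, w) \<in> B}"

lemma cayI: "(x, w) \<in> B \<Longrightarrow> (w - scaleC \<i> x, w + scaleC \<i> x) \<in> cay B"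
  by (auto simp: cay_def)

lemma cayE:
  assumes "(p, q) \<in> cay B"
  obtains x w where "(x, w) \<in> B" "p = w - scaleC \<i> x" "q = w + scaleC \<i> x"
  using assms by (auto simp: cay_def)

lemma cay_diff: "(w + scaleC \<i> x) - (w - scaleC \<i> x) = scaleC (2 * \<i>) (x::'a::chilbert)"
  using scaleC_add_left[of \<i> \<i> x] by simp

text \<open>The inverse transform: \<open>x = (q - p) / (2 \<i>)\<close> and
  \<open>w = (p + q) / 2\<close>.\<close>

lemma mem_cayI:
  assumes "(scaleC (- \<i> / 2) (q - p), scaleC (1 / 2) (p + q)) \<in> B"
  shows "(p, q) \<in> cay B"
proof -
  have half: "scaleC (1 / 2) y + scaleC (1 / 2) y = y" for y :: 'a
    using scaleC_add_left[of "1 / 2" "1 / 2" y] by simp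
  have "p = scaleC (1 / 2) (p + q) - scaleC (1 / 2) (q - p)"
    "q = scaleC (1 / 2) (p + q) + scaleC (1 / 2) (q - p)"
    using half[of p] half[of q] by (simp_all add: scaleC_distribs)
  with cayI[OF assms] show ?thesis by simp
qed

text \<open>The Moebius image of \<open>z\<close> is the coefficient for which \<open>w\<close> and
  \<open>x\<close> combine to a multiple of \<open>w - z x\<close>, so that kernel and range of
  \<open>B - z\<close> can be read off the pencil.\<close>

lemma cay_pencil:
  fixes x w :: "'a::chilbert"
  assumes "z + \<i> \<noteq> 0"
  shows "(w - scaleC \<i> x) - scaleC ((z - \<i>) / (z + \<i>)) (w + scaleC \<i> x)
    = scaleC (2 * \<i> / (z + \<i>)) (w - scaleC z x)"
proof -
  have "1 - (z - \<i>) / (z + \<i>) = 2 * \<i> / (z + \<i>)"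
    "\<i> + (z - \<i>) / (z + \<i>) * \<i> = 2 * \<i> / (z + \<i>) * z"
    using assms by (simp_all add: field_simps)
  then have "scaleC (2 * \<i> / (z + \<i>)) (w - scaleC z x)
    = scaleC (1 - (z - \<i>) / (z + \<i>)) w - scaleC (\<i> + (z - \<i>) / (z + \<i>) * \<i>) x"
    by (simp add: scaleC_diff_right)
  also have "\<dots> = (w - scaleC \<i> x) - scaleC ((z - \<i>) / (z + \<i>)) (w + scaleC \<i> x)"
    by (simp add: scaleC_distribs del: times_divide_eq_left)
  finally show ?thesis by simp
qed

text \<open>This is \<open>cay_pencil\<close> at \<open>- z\<close> and \<open>- x\<close>, which
  exchanges the two components. The reciprocal coefficient is the one inside the unit disc for
  \<open>z\<close> in the lower half plane.\<close>

lemma cay_pencil_converse: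
  fixes x w :: "'a::chilbert"
  assumes "z - \<i> \<noteq> 0"
  shows "(w + scaleC \<i> x) - scaleC ((z + \<i>) / (z - \<i>)) (w - scaleC \<i> x)
    = scaleC (- 2 * \<i> / (z - \<i>)) (w - scaleC z x)"
proof -
  have "(- z - \<i>) / (- z + \<i>) = (z + \<i>) / (z - \<i>)"
    "2 * \<i> / (- z + \<i>) = - 2 * \<i> / (z - \<i>)" "- z + \<i> \<noteq> 0"
    using assms by (auto simp: field_simps eq_neg_iff_add_eq_0)
  then show ?thesis using cay_pencil[of "- z" w "- x"] by simp
qed

section \<open>Spectrum and eigenvalues in terms of the pencil\<close>

text \<open>The bound makes \<open>B - z\<close> injective, so preimages \<open>R g\<close> are
  unique, which yields linearity of \<open>R\<close>; the bound itself is then boundedness of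
  \<open>R\<close>.\<close>

lemma not_in_spectrum_iff:
  fixes B :: "('a::chilbert \<times> 'a) set"
  assumes B: "lin_op B"
  shows "z \<notin> spectrum_op B \<longleftrightarrow>
    (\<forall>g. \<exists>(x, w)\<in>B. w - scaleC z x = g) \<and>
    (\<exists>K. \<forall>(x, w)\<in>B. norm x \<le> K * norm (w - scaleC z x))" (is "_ \<longleftrightarrow> ?surj \<and> ?bdd")
proof
  assume "z \<notin> spectrum_op B"
  then obtain R where R: "bounded_clinear R"
    "{(w - scaleC z x, x) | x w. (x, w) \<in> B} = {(y, R y) | y. True}"
    by (auto simp: spectrum_op_def)
  have ?surj
  proof
    fix g
    have "(g, R g) \<in> {(w - scaleC z x, x) | x w. (x, w) \<in> B}" unfolding R(2) by blast
    then show "\<exists>(x, w)\<in>B. w - scaleC z x = g" by blast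
  qed
  moreover have "x = R (w - scaleC z x)" if "(x, w) \<in> B" for x w
  proof -
    have "(w - scaleC z x, x) \<in> {(y, R y) | y. True}" unfolding R(2)[symmetric] using that by blast
    then show ?thesis by blast
  qed
  then have ?bdd using R(1) unfolding bounded_clinear_def by (metis (no_types, lifting) case_prodI2)
  ultimately show "?surj \<and> ?bdd" by blast
next
  assume *: "?surj \<and> ?bdd"
  then obtain K where K: "\<And>x w. (x, w) \<in> B \<Longrightarrow> norm x \<le> K * norm (w - scaleC z x)" by blast
  have "\<forall>g. \<exists>x w. (x, w) \<in> B \<and> w - scaleC z x = g" using * by blast
  then obtain R W where RW: "\<And>g. (R g, W g) \<in> B" "\<And>g. W g - scaleC z (R g) = g" by metis
  have add: "(x + u, y + v) \<in> B" if "(x, y) \<in> B" "(u, v) \<in> B" for x y u v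
    using B that unfolding lin_op_def by blast
  have scale: "(scaleC a x, scaleC a y) \<in> B" if "(x, y) \<in> B" for a x y
    using B that unfolding lin_op_def by blast
  have uniq: "x = R g" if "(x, w) \<in> B" "w - scaleC z x = g" for x w g
  proof -
    have "(x - R g, w - W g) \<in> B"
      using add[OF that(1) scale[OF RW(1)[of g], of "-1"]] by simp
    moreover have "w - W g - scaleC z (x - R g) = 0"
      using that(2) RW(2)[of g] by (simp add: scaleC_diff_right algebra_simps)
    ultimately show ?thesis using K[of "x - R g" "w - W g"] by simp
  qed
  have "R (g + h) = R g + R h" for g h
    by (rule uniq[symmetric, OF add[OF RW(1)[of g] RW(1)[of h]]])
      (metis (no_types, lifting) RW(2) add_diff_add scaleC_add_right)
  moreover have "R (scaleC a g) = scaleC a (R g)" for a g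
    by (rule uniq[symmetric, OF scale[OF RW(1)[of g]]])
      (metis (no_types, lifting) RW(2) mult.commute scaleC_diff_right scaleC_scaleC)
  moreover have "norm (R g) \<le> K * norm g" for g using K[OF RW(1)[of g]] RW(2) by simp
  ultimately have "bounded_clinear R" unfolding bounded_clinear_def clinear_def by blast
  moreover have "{(w - scaleC z x, x) | x w. (x, w) \<in> B} = {(y, R y) | y. True}"
  proof (intro equalityI subsetI)
    fix v assume "v \<in> {(w - scaleC z x, x) | x w. (x, w) \<in> B}"
    then show "v \<in> {(y, R y) | y. True}" using uniq by blast
  next
    fix v assume "v \<in> {(y, R y) | y. True}"
    then obtain y where "v = (y, R y)" by blast
    then have "v = (W y - scaleC z (R y), R y)" by (simp only: RW(2))
    then show "v \<in> {(w - scaleC z x, x) | x w. (x, w) \<in> B}" using RW(1) by blast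
  qed
  ultimately show "z \<notin> spectrum_op B" unfolding spectrum_op_def by blast
qed

text \<open>\<open>T\<close> stands for \<open>p - \<epsilon> q\<close> or
  \<open>q - \<epsilon> p\<close>, so that one argument covers both half planes.\<close>

lemma not_in_spectrum_of_pencil:
  fixes B :: "('a::chilbert \<times> 'a) set"
  assumes B: "lin_op B" and c: "c \<noteq> 0"
    and T: "\<And>x w. (x, w) \<in> B \<Longrightarrow> T (w - scaleC \<i> x) (w + scaleC \<i> x) = scaleC c (w - scaleC z x)"
    and surj: "\<And>g. \<exists>p q. (p, q) \<in> cay B \<and> T p q = g"
    and bdd: "\<exists>K. \<forall>(p, q)\<in>cay B. norm (q - p) \<le> K * norm (T p q)"
  shows "z \<notin> spectrum_op B"
  unfolding not_in_spectrum_iff[OF B]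
proof (intro conjI allI)
  fix g
  obtain p q where "(p, q) \<in> cay B" "T p q = scaleC c g" using surj by blast
  then obtain x w where xw: "(x, w) \<in> B" "scaleC c (w - scaleC z x) = scaleC c g"
    using T by (metis cayE)
  then have "scaleC c (w - scaleC z x - g) = 0" by (simp only: scaleC_diff_right) simp
  then have "w - scaleC z x = g" using c by simp
  then show "\<exists>(x, w)\<in>B. w - scaleC z x = g" using xw(1) by blast
next
  obtain K where K: "\<And>p q. (p, q) \<in> cay B \<Longrightarrow> norm (q - p) \<le> K * norm (T p q)" using bdd by blast
  have "norm x \<le> (K * cmod c / 2) * norm (w - scaleC z x)" if "(x, w) \<in> B" for x w
    using K[OF cayI[OF that]] unfolding T[OF that] cay_diff by (simp add: norm_mult)
  then show "\<exists>K. \<forall>(x, w)\<in>B. norm x \<le> K * norm (w - scaleC z x)" by blast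
qed

lemma eigenvalue_of_pencil:
  assumes c: "c \<noteq> 0"
    and T: "\<And>x w. (x, w) \<in> B \<Longrightarrow> T (w - scaleC \<i> x) (w + scaleC \<i> x) = scaleC c (w - scaleC z x)"
    and pq: "(p, q) \<in> cay B" "T p q = 0" "p \<noteq> 0 \<or> q \<noteq> 0"
  shows "eigenvalue_op B z"
proof -
  obtain x w where xw: "(x, w) \<in> B" "p = w - scaleC \<i> x" "q = w + scaleC \<i> x"
    using pq(1) by (rule cayE)
  then have w: "w = scaleC z x" using pq(2) T c by simp
  then have "x \<noteq> 0" using pq(3) xw by auto
  then show ?thesis using xw(1) w unfolding eigenvalue_op_def by blast
qed

lemma eigenvalue_in_spectrum:
  assumes "lin_op B" "eigenvalue_op B z"
  shows "z \<in> spectrum_op B"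
proof (rule ccontr)
  assume "z \<notin> spectrum_op B"
  then obtain K where K: "\<forall>(x, w)\<in>B. norm x \<le> K * norm (w - scaleC z x)"
    using not_in_spectrum_iff[OF assms(1)] by blast
  obtain x where "x \<noteq> 0" "(x, scaleC z x) \<in> B" using assms(2) by (auto simp: eigenvalue_op_def)
  with K show False by fastforce
qed

lemma cmod_upper_half_plane:
  assumes "Im z > 0"
  shows "z + \<i> \<noteq> 0" "cmod ((z - \<i>) / (z + \<i>)) < 1"
proof -
  show nz: "z + \<i> \<noteq> 0" using assms by (auto simp: complex_eq_iff)
  have "(cmod (z - \<i>))\<^sup>2 < (cmod (z + \<i>))\<^sup>2"
    unfolding cmod_power2 using assms by (simp add: power2_eq_square algebra_simps)
  then have "cmod (z - \<i>) < cmod (z + \<i>)" by (rule power2_less_imp_less) simp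
  then show "cmod ((z - \<i>) / (z + \<i>)) < 1" using nz by (simp add: norm_divide)
qed

lemma cmod_lower_half_plane:
  assumes "Im z < 0"
  shows "z - \<i> \<noteq> 0" "cmod ((z + \<i>) / (z - \<i>)) < 1"
proof -
  show nz: "z - \<i> \<noteq> 0" using assms by (auto simp: complex_eq_iff)
  have "(cmod (z + \<i>))\<^sup>2 < (cmod (z - \<i>))\<^sup>2"
    unfolding cmod_power2 using assms by (simp add: power2_eq_square algebra_simps)
  then have "cmod (z + \<i>) < cmod (z - \<i>)" by (rule power2_less_imp_less) simp
  then show "cmod ((z + \<i>) / (z - \<i>)) < 1" using nz by (simp add: norm_divide)
qed

section \<open>From the extension to a shift relation\<close>

lemma orth_proj_range:
  assumes "finite E" "orthonormal E"
  shows "orth {x. proj E x = x} = {h. proj E h = 0}"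
proof (intro equalityI subsetI)
  fix h assume "h \<in> orth {x. proj E x = x}"
  then have "\<forall>e\<in>E. cinner e h = 0" using proj_self[OF assms] by (auto simp: orth_def)
  then show "h \<in> {h. proj E h = 0}" by (simp add: proj_eq_0_iff[OF assms])
next
  fix h assume "h \<in> {h. proj E h = 0}"
  then have h: "\<forall>e\<in>E. cinner e h = 0" by (simp add: proj_eq_0_iff[OF assms])
  show "h \<in> orth {x. proj E x = x}"
    using cinner_proj_orth[OF _ h] cinner_eq_0_commute unfolding orth_def by blast
qed

text \<open>Three inclusions supply the main axioms: \<open>C_ext\<close> comes from the extension
  property, \<open>C_dec\<close> from \<open>B\<close> lying in the adjoint of the Phillips
  operator, and \<open>C_max\<close> from \<open>J\<close> carrying the adjoint of \<open>B\<close>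
  back into \<open>B\<close>.\<close>

lemma phillips_shift_relation:
  fixes U J :: "'h::chilbert \<Rightarrow> 'h"
  assumes shift: "bilateral_shift U W0" and J: "fundamental_symmetry J"
    and comm: "commutes_with J (phillips_op U W0)"
    and BJ: "J_selfadjoint J B" and SB: "phillips_op U W0 \<subseteq> B"
  obtains E e where "e \<in> E" "shift_relation U (inv U) E (cay B) J"
proof -
  have linU: "clinear U" and surjU: "surj U" and cU: "cinner (U x) (U y) = cinner x y" for x y
    using shift by (auto simp: bilateral_shift_def unitary_def)
  have injU: "inj U"
  proof (rule injI)
    fix x y assume "U x = U y"
    then have "cinner (x - y) (x - y) = 0" using cU[of "x - y" "x - y"] by (simp add: clinear_simps[OF linU])
    then show "x = y" by simp
  qed
  have UU': "U (inv U x) = x" for x by (rule surj_f_inv_f[OF surjU])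
  have U'U: "inv U (U x) = x" for x by (rule inv_f_f[OF injU])
  obtain F where F: "finite F" "W0 = cspan F" using shift by (auto simp: bilateral_shift_def)
  obtain E where E: "finite E" "orthonormal E" "W0 = {x. proj E x = x}"
    using cspan_orthonormal_basis[OF F(1)] F(2) by metis
  have orthW: "orth W0 = {h. proj E h = 0}" using orth_proj_range[OF E(1,2)] E(3) by simp
  have "W0 \<noteq> {0}" using shift by (simp add: bilateral_shift_def)
  then have "E \<noteq> {}" using E(3) by (auto simp: proj_def)
  then obtain e where e: "e \<in> E" by blast
  have linB: "lin_op B" using BJ by (simp add: J_selfadjoint_def densely_defined_def)
  have linJ: "clinear J" and JJ: "J (J x) = x" and cJ: "cinner (J x) y = cinner x (J y)" for x y
    using J by (auto simp: fundamental_symmetry_def bounded_clinear_def)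
  have eq: "op_comp_right (adjoint_op B) J = op_comp_left J B"
    using BJ by (simp add: J_selfadjoint_def)
  \<comment> \<open>\<open>adj1\<close> and \<open>adj2\<close> are the two inclusions in
    \<open>B\<^sup>* J = J B\<close>: applied to both components, \<open>J\<close> maps the graph of
    \<open>B\<close> into that of its adjoint and back.\<close>
  have adj1: "(J x, J w) \<in> adjoint_op B" if "(x, w) \<in> B" for x w
  proof -
    have "(x, J w) \<in> op_comp_left J B" using that by (auto simp: op_comp_left_def)
    then show ?thesis unfolding eq[symmetric] by (simp add: op_comp_right_def)
  qed
  have adj2: "(J y, J z) \<in> B" if "(y, z) \<in> adjoint_op B" for y z
  proof -
    have "(J y, z) \<in> op_comp_right (adjoint_op B) J" using that by (simp add: op_comp_right_def JJ)
    then have "(J y, z) \<in> op_comp_left J B" by (simp only: eq)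
    then show ?thesis by (auto simp: op_comp_left_def JJ)
  qed
  \<comment> \<open>Commutation puts \<open>(J u, J v)\<close> into \<open>B\<close>. Pairing it
    with \<open>(J x, J w)\<close> from the adjoint cancels \<open>J\<close>.\<close>
  have S_adj: "cinner v x = cinner u w" if "(u, v) \<in> phillips_op U W0" "(x, w) \<in> B" for u v x w
  proof -
    have "(J u, J v) \<in> B" using comm that(1) SB by (auto simp: commutes_with_def)
    with adj1[OF that(2)] have "cinner (J v) (J x) = cinner (J u) (J w)"
      by (auto simp: adjoint_op_def)
    then show ?thesis by (simp add: cJ JJ)
  qed
  have "shift_relation U (inv U) E (cay B) J"
  proof
    show "clinear (inv U)"
      unfolding clinear_def by (metis U'U UU' clinear_simps(1,2)[OF linU])
    show "cinner e ((U ^^ Suc k) f) = 0" if "e \<in> E" "f \<in> E" for e f k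
    proof -
      have wand: "\<forall>x\<in>upow U m ` W0. \<forall>y\<in>upow U n ` W0. cinner x y = 0" if "m \<noteq> n" for m n
        using shift that by (simp add: bilateral_shift_def)
      have "e \<in> upow U 0 ` W0"
        using that(1) E proj_self by (force simp: upow_def)
      moreover have "(U ^^ Suc k) f \<in> upow U (int (Suc k)) ` W0"
        using that(2) E proj_self by (force simp: upow_def simp del: of_nat_Suc funpow.simps)
      moreover have "0 \<noteq> int (Suc k)" by simp
      ultimately show ?thesis using wand by blast
    qed
    show "(0, 0) \<in> cay B" by (rule mem_cayI) (use linB in \<open>simp add: lin_op_def\<close>)
    show "(x + u, y + v) \<in> cay B" if xy: "(x, y) \<in> cay B" and uv: "(u, v) \<in> cay B" for x y u v
    proof -
      obtain x1 w1 where 1: "(x1, w1) \<in> B" "x = w1 - scaleC \<i> x1" "y = w1 + scaleC \<i> x1"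
        using xy by (rule cayE)
      obtain x2 w2 where 2: "(x2, w2) \<in> B" "u = w2 - scaleC \<i> x2" "v = w2 + scaleC \<i> x2"
        using uv by (rule cayE)
      have "(x1 + x2, w1 + w2) \<in> B" using linB 1(1) 2(1) unfolding lin_op_def by blast
      from cayI[OF this] show ?thesis unfolding 1 2 by (simp add: scaleC_distribs algebra_simps)
    qed
    show "(scaleC c x, scaleC c y) \<in> cay B" if xy: "(x, y) \<in> cay B" for c x y
    proof -
      obtain x1 w1 where 1: "(x1, w1) \<in> B" "x = w1 - scaleC \<i> x1" "y = w1 + scaleC \<i> x1"
        using xy by (rule cayE)
      have "(scaleC c x1, scaleC c w1) \<in> B" using linB 1(1) unfolding lin_op_def by blast
      from cayI[OF this] show ?thesis unfolding 1 by (simp add: scaleC_distribs mult.commute)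
    qed
    show "(h, U h) \<in> cay B" if "proj E h = 0" for h
    proof (rule mem_cayI)
      \<comment> \<open>The factor \<open>- \<i> / 2\<close> cancels the \<open>2 \<i>\<close> that
        the Cayley transform produces on the Phillips operator.\<close>
      have "scaleC (- \<i> / 2) h \<in> orth W0" using that by (simp add: orthW proj_simps)
      then have "(U (scaleC (- \<i> / 2) h) - scaleC (- \<i> / 2) h,
          scaleC \<i> (U (scaleC (- \<i> / 2) h) + scaleC (- \<i> / 2) h)) \<in> phillips_op U W0"
        unfolding phillips_op_def by blast
      then show "(scaleC (- \<i> / 2) (U h - h), scaleC (1 / 2) (h + U h)) \<in> B"
        using SB by (auto simp: clinear_simps[OF linU] scaleC_distribs add.commute)
    qed
    show "proj E (inv U q - p) = inv U q - p" if "(p, q) \<in> cay B" for p q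
    proof -
      obtain x w where xw: "(x, w) \<in> B" "p = w - scaleC \<i> x" "q = w + scaleC \<i> x"
        using \<open>(p, q) \<in> cay B\<close> by (rule cayE)
      \<comment> \<open>\<open>u\<close> is the part of \<open>d\<close> orthogonal to
        \<open>W0\<close>. Testing with the element of the Phillips operator generated by
        \<open>u\<close> gives \<open>cinner u d = 0\<close>, hence \<open>u = 0\<close>.\<close>
      define d u where "d = inv U q - p" and "u = d - proj E d"
      have u: "proj E u = 0" by (simp add: u_def proj_simps proj_proj E)
      then have "(U u - u, scaleC \<i> (U u + u)) \<in> phillips_op U W0"
        by (auto simp: phillips_op_def orthW)
      from S_adj[OF this xw(1)]
      have "cinner (U u) q = cinner u p"
        unfolding xw(2,3) by (simp add: cinner_distribs algebra_simps)
      moreover have "cinner (U u) q = cinner u (inv U q)" using cU[of u "inv U q"] UU' by simp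
      ultimately have "cinner u d = 0" by (simp add: d_def cinner_diff_right)
      moreover have "cinner u (proj E d) = 0"
        by (rule cinner_proj_orth[where E = E])
          (use u in \<open>simp_all add: proj_proj E proj_eq_0_iff\<close>)
      ultimately have "cinner u u = 0" by (subst (2) u_def) (simp add: cinner_diff_right)
      then show ?thesis by (simp add: u_def d_def)
    qed
    show "(J p', J q') \<in> cay B"
      if *: "\<And>p q. (p, q) \<in> cay B \<Longrightarrow> cinner p p' = cinner q q'" for p' q'
    proof (rule mem_cayI)
      \<comment> \<open>The premise on \<open>(p', q')\<close> says exactly that its inverse Cayley
        transform belongs to the adjoint of \<open>B\<close>.\<close>
      have "cinner w (scaleC (- \<i> / 2) (q' - p')) = cinner x (scaleC (1 / 2) (p' + q'))"
        if "(x, w) \<in> B" for x w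
      proof -
        have "cinner w q' - cinner w p' = \<i> * (cinner x p' + cinner x q')"
          using *[OF cayI[OF that]] by (simp add: cinner_distribs algebra_simps)
        then have "- \<i> / 2 * (cinner w q' - cinner w p') = 1 / 2 * (cinner x p' + cinner x q')"
          by (simp add: field_simps)
        then show ?thesis by (simp only: cinner_scaleC_right cinner_diff_right cinner_add_right)
      qed
      then have "(scaleC (- \<i> / 2) (q' - p'), scaleC (1 / 2) (p' + q')) \<in> adjoint_op B"
        unfolding adjoint_op_def by blast
      from adj2[OF this]
      show "(scaleC (- \<i> / 2) (J q' - J p'), scaleC (1 / 2) (J p' + J q')) \<in> B"
        by (simp only: clinear_simps[OF linJ])
    qed
    show "J x = 0 \<longleftrightarrow> x = 0" for x
      using JJ[of x] clinear_simps(3)[OF linJ] by auto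
  qed (rule linU UU' U'U cU E)+
  then show ?thesis using that e by blast
qed

theorem theorem3p7:
  fixes U J :: "'h::chilbert \<Rightarrow> 'h" and W0 :: "'h set" and B :: "('h \<times> 'h) set"
  assumes "bilateral_shift U W0"
    and "fundamental_symmetry J"
    and "commutes_with J (phillips_op U W0)"
    and "J_selfadjoint J B"
    and "phillips_op U W0 \<subseteq> B"
  shows "spectrum_op B = range complex_of_real \<or>
         (spectrum_op B = UNIV \<and> (\<forall>z\<in>spectrum_op B. Im z \<noteq> 0 \<longrightarrow> eigenvalue_op B z))"
proof -
  obtain E e where e: "e \<in> E" and "shift_relation U (inv U) E (cay B) J"
    using phillips_shift_relation[OF assms] .
  then interpret up: shift_relation U "inv U" E "cay B" J by blast
  interpret low: shift_relation "inv U" U "U ` E" "(cay B)\<inverse>" J by (rule up.converse_shift_relation)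
  have linB: "lin_op B" using assms(4) by (simp add: J_selfadjoint_def densely_defined_def)
  \<comment> \<open>A resolvent bound at a real point would become a lower bound for
    \<open>h - \<epsilon> U h\<close> on the complement of \<open>W0\<close> with
    \<open>cmod \<epsilon> = 1\<close>, contrary to \<open>not_bounded_below\<close>.\<close>
  have real: "complex_of_real t \<in> spectrum_op B" for t
  proof (rule ccontr)
    let ?z = "complex_of_real t"
    let ?\<epsilon> = "(?z - \<i>) / (?z + \<i>)"
    assume "?z \<notin> spectrum_op B"
    then obtain K where K: "\<And>x w. (x, w) \<in> B \<Longrightarrow> norm x \<le> K * norm (w - scaleC ?z x)"
      using not_in_spectrum_iff[OF linB] by blast
    have nz: "?z + \<i> \<noteq> 0" by (simp add: complex_eq_iff)
    have \<epsilon>: "cmod ?\<epsilon> = 1"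
      using nz complex_mod_cnj[of "?z + \<i>"] by (simp add: norm_divide)
    have \<epsilon>1: "1 - ?\<epsilon> \<noteq> 0" using nz by (simp add: field_simps)
    have "norm h \<le> (1 + K * cmod (?z + \<i>)) / cmod (1 - ?\<epsilon>) * norm (h - scaleC ?\<epsilon> (U h))"
      if h: "proj E h = 0" for h
    proof -
      obtain x w where xw: "(x, w) \<in> B" "h = w - scaleC \<i> x" "U h = w + scaleC \<i> x"
        using up.C_ext[OF h] by (rule cayE)
      have "norm (h - scaleC ?\<epsilon> (U h)) = 2 / cmod (?z + \<i>) * norm (w - scaleC ?z x)"
        unfolding xw(2,3)[symmetric] using cay_pencil[OF nz, of w x]
        by (simp add: xw(2,3)[symmetric] norm_divide norm_mult)
      then have nw: "norm (w - scaleC ?z x) = cmod (?z + \<i>) / 2 * norm (h - scaleC ?\<epsilon> (U h))"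
        using nz by (simp add: field_simps)
      have "norm (U h - h) = 2 * norm x"
        using cay_diff[of w x] unfolding xw(2,3)[symmetric] by (simp add: norm_mult)
      also have "\<dots> \<le> K * cmod (?z + \<i>) * norm (h - scaleC ?\<epsilon> (U h))"
        using K[OF xw(1)] unfolding nw by simp
      finally have d: "norm (U h - h) \<le> K * cmod (?z + \<i>) * norm (h - scaleC ?\<epsilon> (U h))" .
      \<comment> \<open>Since \<open>?\<epsilon> \<noteq> 1\<close>, \<open>h\<close> is recovered
        from the pencil and from \<open>U h - h\<close>, a multiple of \<open>x\<close>.\<close>
      have "scaleC (1 - ?\<epsilon>) h = (h - scaleC ?\<epsilon> (U h)) + scaleC ?\<epsilon> (U h - h)"
        by (simp only: scaleC_distribs scaleC_one) simp
      then have "cmod (1 - ?\<epsilon>) * norm h \<le> norm (h - scaleC ?\<epsilon> (U h)) + cmod ?\<epsilon> * norm (U h - h)"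
        by (metis norm_scaleC norm_triangle_ineq)
      also have "\<dots> \<le> (1 + K * cmod (?z + \<i>)) * norm (h - scaleC ?\<epsilon> (U h))"
        using d \<epsilon> by (simp add: distrib_right)
      finally show ?thesis using \<epsilon>1 by (simp add: pos_le_divide_eq mult.commute)
    qed
    then show False using up.not_bounded_below[OF \<epsilon> e] by blast
  qed
  have upT: "w - scaleC \<i> x - scaleC ((z - \<i>) / (z + \<i>)) (w + scaleC \<i> x)
      = scaleC (2 * \<i> / (z + \<i>)) (w - scaleC z x)" "2 * \<i> / (z + \<i>) \<noteq> 0"
    if "Im z > 0" for z and x w :: 'h
    using cay_pencil cmod_upper_half_plane(1)[OF that] by simp_all
  have lowT: "w + scaleC \<i> x - scaleC ((z + \<i>) / (z - \<i>)) (w - scaleC \<i> x)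
      = scaleC (- 2 * \<i> / (z - \<i>)) (w - scaleC z x)" "- 2 * \<i> / (z - \<i>) \<noteq> 0"
    if "Im z < 0" for z and x w :: 'h
    using cay_pencil_converse cmod_lower_half_plane(1)[OF that] by simp_all
  show ?thesis
  \<comment> \<open>The condition does not involve \<open>z\<close>, so each case settles all
    non-real points at once.\<close>
  proof (cases "\<exists>a. (a, 0) \<in> cay B \<and> a \<noteq> 0")
    case True
    then obtain a where a: "(a, 0) \<in> cay B" "a \<noteq> 0" by blast
    \<comment> \<open>In the converse relation \<open>a\<close> is a nonzero partner of
      \<open>0\<close>, so \<open>snd_zero_trivial_imp\<close> there cannot have a trivial kernel;
      this supplies \<open>b\<close>, needed for the upper half plane.\<close>
    obtain b where b: "(0, b) \<in> cay B" "b \<noteq> 0"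
      using low.snd_zero_trivial_imp[of a] a by auto
    have "eigenvalue_op B z" if "Im z \<noteq> 0" for z
    proof (cases "Im z > 0")
      case True
      obtain q where "q \<noteq> 0" "(scaleC ((z - \<i>) / (z + \<i>)) q, q) \<in> cay B"
        using up.eigen_exists[OF b cmod_upper_half_plane(2)[OF True]] .
      then show ?thesis
        by (intro eigenvalue_of_pencil[where T = "\<lambda>p q. p - scaleC ((z - \<i>) / (z + \<i>)) q"
              and q = q, OF upT(2)[OF True] upT(1)[OF True]]) auto
    next
      case False
      then have z: "Im z < 0" using that by simp
      obtain p where "p \<noteq> 0" "(scaleC ((z + \<i>) / (z - \<i>)) p, p) \<in> (cay B)\<inverse>"
        using low.eigen_exists[of a, OF _ a(2) cmod_lower_half_plane(2)[OF z]] a(1) by blast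
      then show ?thesis
        by (intro eigenvalue_of_pencil[where T = "\<lambda>p q. q - scaleC ((z + \<i>) / (z - \<i>)) p"
              and p = p, OF lowT(2)[OF z] lowT(1)[OF z]]) auto
    qed
    moreover have "z \<in> spectrum_op B" if "Im z = 0" for z
      using real[of "Re z"] that by (simp add: complex_is_Real_iff)
    ultimately show ?thesis using eigenvalue_in_spectrum[OF linB] by blast
  next
    case False
    then have triv: "\<And>a. (a, 0) \<in> cay B \<Longrightarrow> a = 0" by blast
    then have triv': "\<And>b. (b, 0) \<in> (cay B)\<inverse> \<Longrightarrow> b = 0"
      using up.snd_zero_trivial_imp by blast
    have "z \<notin> spectrum_op B" if "Im z \<noteq> 0" for z
    proof (cases "Im z > 0")
      case True
      show ?thesis
        by (rule not_in_spectrum_of_pencil[where T = "\<lambda>p q. p - scaleC ((z - \<i>) / (z + \<i>)) q",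
              OF linB upT(2)[OF True] upT(1)[OF True]])
          (use up.regular[OF triv cmod_upper_half_plane(2)[OF True]] in blast)+
    next
      case False
      then have z: "Im z < 0" using that by simp
      note reg = low.regular[OF triv' cmod_lower_half_plane(2)[OF z]]
      show ?thesis
      proof (rule not_in_spectrum_of_pencil[where T = "\<lambda>p q. q - scaleC ((z + \<i>) / (z - \<i>)) p",
              OF linB lowT(2)[OF z] lowT(1)[OF z]])
        show "\<exists>p q. (p, q) \<in> cay B \<and> q - scaleC ((z + \<i>) / (z - \<i>)) p = g" for g
          using reg(1)[of g] by blast
        show "\<exists>K. \<forall>(p, q)\<in>cay B. norm (q - p) \<le> K * norm (q - scaleC ((z + \<i>) / (z - \<i>)) p)"
        proof -
          obtain K where K: "\<forall>(p, q)\<in>(cay B)\<inverse>.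
              norm (q - p) \<le> K * norm (p - scaleC ((z + \<i>) / (z - \<i>)) q)"
            using reg(2) by blast
          have "norm (q - p) \<le> K * norm (q - scaleC ((z + \<i>) / (z - \<i>)) p)"
            if "(p, q) \<in> cay B" for p q
            using K that by (auto simp: norm_minus_commute[of q p])
          then show ?thesis by blast
        qed
      qed
    qed
    then have "spectrum_op B \<subseteq> \<real>" using complex_is_Real_iff by blast
    then have "spectrum_op B = range complex_of_real" using real unfolding Reals_def by blast
    then show ?thesis by blast
  qed
qed

end
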